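(* Let $n\ge1$ and let $F\subset\mathbb{R}^n$ be non-empty and bounded. Let $K_F=\bigcap_{a\in\mathcal K_n}\{\alpha\in[0,\infty)^n:\alpha\cdot a\le\underline\rho_F(a)\}$. For every $a\in\mathcal K_n$, $$h_{K_F}(a):=\max_{\alpha\in K_F}\alpha\cdot a=\sup_{\alpha\in\underline{\mathrm P}(F)}\alpha\cdot a\le\underline\rho_F(a)$$ (in particular the maximum is attained). Equality $h_{K_F}=\underline\rho_F$ holds throughout $\mathcal K_n$ if and only if $\underline\rho_F$ is subadditive on $\mathcal K_n$, i.e. $\underline\rho_F(a+b)\le\underline\rho_F(a)+\underline\rho_F(b)$ for all $a,b\in\mathcal K_n$. In this case, $\underline\rho_F(a)=\sup_{\alpha\in\underline{\mathrm P}(F)}\alpha\cdot a$ for every $a\in\mathcal K_n$.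
   Context: An open box in $\mathbb{R}^n$ is an open rectangular box with positive side lengths and arbitrary orientation; its side lengths in decreasing order are $l_1(B)\ge\cdots\ge l_n(B)>0$. Let $\Delta_n=\{\delta\in(0,1)^n:\delta_1\ge\cdots\ge\delta_n\}$. For non-empty bounded $F\subset\mathbb{R}^n$ and $\delta\in\Delta_n$, $N(F;\delta)$ is the least number of open boxes $B$ needed to cover $F$, subject to $l_i(B)\le\delta_i$ for $1\le i\le n$ for every box in the cover (boxes may have different orientations). For $\alpha\in[0,\infty)^n$ write $\delta^\alpha=\prod_i\delta_i^{\alpha_i}$. The lower box dimension print is $$\underline{\mathrm P}(F)=\Bigl\{\alpha\in[0,\infty)^n:\ \liminf_{\delta\in\Delta_n,\ \delta_1\downarrow0}N(F;\delta)\delta^\alpha>0\Bigr\},$$ the lower limit being over all of $\Delta_n$ as $\delta_1\downarrow0$. Let $\mathcal K_n=\{a\in(0,\infty)^n:a_1\le\cdots\le a_n\}$. For $a\in\mathcal K_n$ and $t>0$ let $e^{-ta}=(e^{-ta_1},\dots,e^{-ta_n})\in\Delta_n$. The lower eccentricity profile is $\underline\rho_F(a)=\liminf_{t\to\infty}\frac1t\log N(F;e^{-ta})$. *)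

theory Defs
  imports "HOL-Analysis.Analysis"
begin

text \<open>
  The space \<open>\<real>\<^sup>n\<close> is rendered as \<open>real ^ 'n\<close> with \<open>'n :: {finite, linorder}\<close>, where
  \<open>n = CARD('n) \<ge> 1\<close>; the linear order on \<open>'n\<close> is the order of the coordinate indices
  \<open>1 < \<dots> < n\<close>, so that \<open>Min UNIV\<close> is the index of the first coordinate.
\<close>

definition nonneg_orthant :: "(real ^ 'n::finite) set" where
  "nonneg_orthant = {\<alpha>. \<forall>i. 0 \<le> \<alpha> $ i}"

definition Delta :: "(real ^ 'n::{finite,linorder}) set" where
  "Delta = {\<delta>. (\<forall>i. 0 < \<delta> $ i \<and> \<delta> $ i < 1) \<and> (\<forall>i j. i \<le> j \<longrightarrow> \<delta> $ j \<le> \<delta> $ i)}"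

definition eccentricity_cone :: "(real ^ 'n::{finite,linorder}) set" where
  "eccentricity_cone = {a. (\<forall>i. 0 < a $ i) \<and> (\<forall>i j. i \<le> j \<longrightarrow> a $ i \<le> a $ j)}"

text \<open>
  \<open>is_open_box l B\<close>: the set \<open>B\<close> is an open box of arbitrary orientation whose side lengths in
  decreasing order are the coordinates of \<open>l\<close>. The isometry carrying the axis-parallel box to \<open>B\<close>
  may reverse orientation; this yields no further sets, since \<open>box 0 l\<close> is mapped to
  itself by the reflection in a hyperplane through its centre orthogonal to an edge.
\<close>

definition is_open_box :: "real ^ 'n::{finite,linorder} \<Rightarrow> (real ^ 'n::{finite,linorder}) set \<Rightarrow> bool" where
  "is_open_box l B \<longleftrightarrow>
     (\<forall>i. 0 < l $ i) \<and> (\<forall>i j. i \<le> j \<longrightarrow> l $ j \<le> l $ i) \<and>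
     (\<exists>f c. orthogonal_transformation f \<and> B = (\<lambda>x. c + f x) ` box 0 l)"

definition box_cover :: "(real ^ 'n::{finite,linorder}) set \<Rightarrow> real ^ 'n::{finite,linorder} \<Rightarrow> (real ^ 'n::{finite,linorder}) set set \<Rightarrow> bool" where
  "box_cover F \<delta> \<C> \<longleftrightarrow>
     finite \<C> \<and> F \<subseteq> \<Union>\<C> \<and> (\<forall>B\<in>\<C>. \<exists>l. is_open_box l B \<and> (\<forall>i. l $ i \<le> \<delta> $ i))"

definition box_number :: "(real ^ 'n::{finite,linorder}) set \<Rightarrow> real ^ 'n::{finite,linorder} \<Rightarrow> nat" where
  "box_number F \<delta> = (LEAST k. \<exists>\<C>. box_cover F \<delta> \<C> \<and> card \<C> = k)"

definition multi_powr :: "real ^ 'n::finite \<Rightarrow> real ^ 'n::finite \<Rightarrow> real" where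
  "multi_powr \<delta> \<alpha> = (\<Prod>i\<in>UNIV. (\<delta> $ i) powr (\<alpha> $ i))"

text \<open>The filter of \<open>\<delta> \<in> \<Delta>\<^sub>n\<close> as \<open>\<delta>\<^sub>1 \<down> 0\<close>, with no further restriction on the path.\<close>

definition Delta_filter :: "(real ^ 'n::{finite,linorder}) filter" where
  "Delta_filter = inf (filtercomap (\<lambda>\<delta>. \<delta> $ Min UNIV) (at_right 0)) (principal Delta)"

text \<open>Lower limits and suprema are taken in the extended reals, so none is undefined.\<close>

definition lower_print :: "(real ^ 'n::{finite,linorder}) set \<Rightarrow> (real ^ 'n::{finite,linorder}) set" where
  "lower_print F = {\<alpha> \<in> nonneg_orthant.
     0 < Liminf Delta_filter (\<lambda>\<delta>. ereal (real (box_number F \<delta>) * multi_powr \<delta> \<alpha>))}"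

definition exp_scale :: "real \<Rightarrow> real ^ 'n::finite \<Rightarrow> real ^ 'n::finite" where
  "exp_scale t a = (\<chi> i. exp (- (t * a $ i)))"

definition lower_profile :: "(real ^ 'n::{finite,linorder}) set \<Rightarrow> real ^ 'n::{finite,linorder} \<Rightarrow> ereal" where
  "lower_profile F a =
     Liminf at_top (\<lambda>t. ereal (1 / t * ln (real (box_number F (exp_scale t a)))))"

definition profile_body :: "(real ^ 'n::{finite,linorder}) set \<Rightarrow> (real ^ 'n::{finite,linorder}) set" where
  "profile_body F =
     (\<Inter>a\<in>eccentricity_cone. {\<alpha> \<in> nonneg_orthant. ereal (\<alpha> \<bullet> a) \<le> lower_profile F a})"

definition support_fun :: "(real ^ 'n::finite) set \<Rightarrow> real ^ 'n::finite \<Rightarrow> ereal" where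
  "support_fun K a = (SUP \<alpha>\<in>K. ereal (\<alpha> \<bullet> a))"

definition subadditive_on :: "'a::plus set \<Rightarrow> ('a \<Rightarrow> ereal) \<Rightarrow> bool" where
  "subadditive_on S g \<longleftrightarrow> (\<forall>a\<in>S. \<forall>b\<in>S. g (a + b) \<le> g a + g b)"

end

theory Submission
  imports Defs
begin

text \<open>
  Write \<open>L a\<close> for the logarithm of the covering number at the scale vector \<open>e\<^sup>-\<^sup>a\<close>. Then
  \<open>\<rho> a = liminf L (t a) / t\<close> along rays, while a non-negative \<open>\<alpha>\<close> lies in the lower print iff \<open>L a - \<alpha> \<bullet> a\<close> is bounded
  below uniformly for all \<open>a\<close> of the cone with large first coordinate (\<open>lower_print_iff\<close>). So the
  first part of the theorem compares estimates along single rays with an estimate uniform in the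
  direction.

  All geometry enters through one inequality: cutting boxes into smaller ones gives
  \<open>L b \<le> L a + n ln 2 + \<Sum>\<^sub>i max 0 (b\<^sub>i - a\<^sub>i)\<close> (\<open>log_number_quasi_Lipschitz\<close>). After division by \<open>t\<close> the
  constant disappears. Hence \<open>\<rho>\<close> is monotone and finite, and the functions
  \<open>a \<mapsto> L (t a) / t\<close> are asymptotically equi-Lipschitz, so that a lower bound at the
  limit of a sequence of directions passes to the sequence itself. A compactness argument on
  normalised directions then shows \<open>s \<alpha> \<in> P\<close> for \<open>\<alpha> \<in> K\<close> and \<open>0 \<le> s < 1\<close>, where \<open>P\<close> is the lower print and
  \<open>K\<close> the profile body (\<open>scaled_profile_body_in_lower_print\<close>). With the inclusion \<open>P \<subseteq> K\<close> both
  sets have the same support function.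

  A support function is subadditive, which is one half of the equivalence. For the other half, \<open>\<rho>\<close> is
  positively homogeneous and monotone; if it is also subadditive, then the region above its graph,
  closed downwards in the space variable, is a convex cone, and a hyperplane supporting it above \<open>a\<close>
  is the graph of a functional \<open>x \<mapsto> \<alpha> \<bullet> x\<close>, where \<open>\<alpha>\<close> lies in \<open>K\<close> and satisfies \<open>\<alpha> \<bullet> a = \<rho> a\<close>
  (\<open>monotone_sublinear_supporting_vector\<close>).
\<close>

section \<open>Covering numbers in logarithmic scales\<close>

definition log_number :: "(real ^ 'n::{finite,linorder}) set \<Rightarrow> real ^ 'n::{finite,linorder} \<Rightarrow> real" where
  "log_number F a = ln (real (box_number F (exp_scale 1 a)))"

text \<open>
  An edge of length \<open>l\<^sub>i\<close> is covered by \<open>\<lfloor>l\<^sub>i / \<delta>\<^sub>i\<rfloor> + 1\<close> open intervals of length \<open>\<delta>\<^sub>i\<close>, and the products of such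
  intervals, carried along by the isometry, are boxes of the same orientation. The maximum with
  \<open>1\<close> makes the bound valid also in the directions with \<open>\<delta>\<^sub>i > l\<^sub>i\<close>.
\<close>

lemma open_box_subdivision:
  fixes \<delta> :: "real ^ 'n::{finite,linorder}"
  assumes B: "is_open_box l B" and \<delta>: "\<delta> \<in> Delta"
  obtains \<C> where "finite \<C>" "B \<subseteq> \<Union>\<C>" "\<forall>B'\<in>\<C>. is_open_box \<delta> B'"
    "real (card \<C>) \<le> (\<Prod>i\<in>UNIV. 2 * max 1 (l $ i / \<delta> $ i))"
proof -
  obtain f c where f: "orthogonal_transformation f" and Beq: "B = (\<lambda>x. c + f x) ` box 0 l"
    and l: "\<And>i. 0 < l $ i"
    using B unfolding is_open_box_def by blast
  have lin: "linear f" using f by (rule orthogonal_transformation_linear)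
  have \<delta>pos: "0 < \<delta> $ i" for i using \<delta> by (simp add: Delta_def)
  define m where "m i = nat \<lfloor>l $ i / \<delta> $ i\<rfloor> + 1" for i
  define h where "h i = l $ i / real (m i)" for i
  define J where "J = (PiE UNIV (\<lambda>i. {..<m i}))"
  define v :: "('n \<Rightarrow> nat) \<Rightarrow> real ^ 'n::{finite,linorder}" where "v g = (\<chi> i. real (g i) * h i)" for g
  define Q where "Q g = (\<lambda>x. (c + f (v g)) + f x) ` box 0 \<delta>" for g
  have ratio: "0 < l $ i / \<delta> $ i" for i using l[of i] \<delta>pos[of i] by simp
  have m_up: "real (m i) \<le> 2 * max 1 (l $ i / \<delta> $ i)" for i
  proof -
    have "real (m i) = of_int \<lfloor>l $ i / \<delta> $ i\<rfloor> + 1"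
      unfolding m_def using ratio[of i] by simp
    also have "\<dots> \<le> l $ i / \<delta> $ i + 1" by simp
    finally show ?thesis by linarith
  qed
  have mpos: "0 < real (m i)" for i by (simp add: m_def)
  have m_low: "l $ i / \<delta> $ i < real (m i)" for i
    unfolding m_def using ratio[of i] by simp linarith
  have hpos: "0 < h i" for i using l[of i] mpos[of i] by (simp add: h_def)
  have hlt: "h i < \<delta> $ i" for i
    using m_low[of i] mpos[of i] \<delta>pos[of i] by (simp add: h_def field_simps)
  have finJ: "finite J" unfolding J_def by (intro finite_PiE) auto
  have cardJ: "card J = (\<Prod>i\<in>UNIV. m i)" unfolding J_def by (simp add: card_PiE)
  show thesis
  proof (rule that[of "Q ` J"])
    show "finite (Q ` J)" using finJ by simp
    show "\<forall>B'\<in>Q ` J. is_open_box \<delta> B'"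
      unfolding Q_def is_open_box_def using \<delta> f by (auto simp: Delta_def)
    have "real (card (Q ` J)) \<le> real (card J)"
      using card_image_le[OF finJ] by simp
    also have "\<dots> = (\<Prod>i\<in>UNIV. real (m i))" by (simp add: cardJ)
    also have "\<dots> \<le> (\<Prod>i\<in>UNIV. 2 * max 1 (l $ i / \<delta> $ i))"
      by (intro prod_mono) (use m_up in auto)
    finally show "real (card (Q ` J)) \<le> (\<Prod>i\<in>UNIV. 2 * max 1 (l $ i / \<delta> $ i))" .
    show "B \<subseteq> \<Union>(Q ` J)"
    proof
      fix y assume "y \<in> B"
      then obtain x where x: "x \<in> box 0 l" and y: "y = c + f x" using Beq by blast
      have xi: "0 < x $ i" "x $ i < l $ i" for i using x by (auto simp: mem_box_cart)
      (* The half-open cells of side h i partition the edge, and each lies in an open interval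
         of length \<delta> $ i, so x falls into the cell with index \<lceil>x i / h i\<rceil> - 1. *)
      define g where "g i = nat (\<lceil>x $ i / h i\<rceil> - 1)" for i
      have q: "0 < x $ i / h i" for i using xi[of i] hpos[of i] by simp
      have greal: "real (g i) = of_int \<lceil>x $ i / h i\<rceil> - 1" for i
        using q[of i] unfolding g_def by simp
      have glow: "real (g i) < x $ i / h i" and gup: "x $ i / h i \<le> real (g i) + 1" for i
        unfolding greal by linarith+
      have "x $ i / h i < real (m i)" for i
        using xi[of i] hpos[of i] mpos[of i] by (simp add: h_def field_simps)
      then have "g i < m i" for i using glow[of i] by (metis less_trans of_nat_less_iff)
      then have gJ: "g \<in> J" by (auto simp: J_def)
      have "x - v g \<in> box 0 \<delta>"
        unfolding mem_box_cart
      proof (intro allI conjI)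
        fix i
        show "0 $ i < (x - v g) $ i" using glow[of i] hpos[of i] by (simp add: v_def field_simps)
        have "x $ i \<le> real (g i) * h i + h i"
          using gup[of i] hpos[of i] by (simp add: field_simps)
        then show "(x - v g) $ i < \<delta> $ i" using hlt[of i] by (simp add: v_def)
      qed
      moreover have "y = (c + f (v g)) + f (x - v g)"
        unfolding y using linear_diff[OF lin] by simp
      ultimately have "y \<in> Q g" unfolding Q_def by blast
      then show "y \<in> \<Union>(Q ` J)" using gJ by blast
    qed
  qed
qed

text \<open>A bounded set lies in one large cube, which is then subdivided.\<close>

lemma box_cover_exists:
  fixes F :: "(real ^ 'n::{finite,linorder}) set"
  assumes "bounded F" and \<delta>: "\<delta> \<in> Delta"
  shows "\<exists>\<C>. box_cover F \<delta> \<C>"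
proof -
  obtain R where R: "0 < R" "\<And>x. x \<in> F \<Longrightarrow> norm x \<le> R"
    using \<open>bounded F\<close> bounded_pos by blast
  define l :: "real ^ 'n::{finite,linorder}" where "l = (\<chi> i. 4 * R)"
  define c :: "real ^ 'n::{finite,linorder}" where "c = (\<chi> i. - (2 * R))"
  define B where "B = (\<lambda>x. c + id x) ` box 0 l"
  have "is_open_box l B"
    unfolding is_open_box_def B_def
  proof (intro conjI exI)
    show "orthogonal_transformation (id :: real ^ 'n::{finite,linorder} \<Rightarrow> _)"
      by (simp add: orthogonal_transformation_def linear_id)
  qed (use R(1) in \<open>auto simp: l_def\<close>)
  then obtain \<C> where \<C>: "finite \<C>" "B \<subseteq> \<Union>\<C>" "\<forall>B'\<in>\<C>. is_open_box \<delta> B'"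
    using open_box_subdivision \<delta> by metis
  have "F \<subseteq> B"
  proof
    fix x assume "x \<in> F"
    then have x: "- (2 * R) < x $ i" "x $ i < 2 * R" for i
      using R(1) R(2)[of x] component_le_norm_cart[of x i] by linarith+
    have "0 $ i < (x - c) $ i \<and> (x - c) $ i < l $ i" for i
      using x[of i] by (simp add: c_def l_def)
    then have "x - c \<in> box 0 l" by (simp add: mem_box_cart)
    moreover have "x = c + id (x - c)" by simp
    ultimately show "x \<in> B" unfolding B_def by blast
  qed
  then show ?thesis unfolding box_cover_def using \<C> by blast
qed

lemma minimal_box_cover:
  fixes F :: "(real ^ 'n::{finite,linorder}) set"
  assumes "bounded F" and "\<delta> \<in> Delta"
  obtains \<C> where "box_cover F \<delta> \<C>" "card \<C> = box_number F \<delta>"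
proof -
  have "\<exists>k \<C>. box_cover F \<delta> \<C> \<and> card \<C> = k" using box_cover_exists[OF assms] by blast
  from LeastI_ex[OF this] show thesis using that unfolding box_number_def by blast
qed

lemma box_number_le: "box_cover F \<delta> \<C> \<Longrightarrow> box_number F \<delta> \<le> card \<C>"
  unfolding box_number_def by (rule Least_le) blast

lemma box_number_ge_1:
  fixes F :: "(real ^ 'n::{finite,linorder}) set"
  assumes "F \<noteq> {}" "bounded F" "\<delta> \<in> Delta"
  shows "1 \<le> box_number F \<delta>"
proof -
  obtain \<C> where \<C>: "box_cover F \<delta> \<C>" "card \<C> = box_number F \<delta>"
    using minimal_box_cover[OF assms(2,3)] .
  then have "\<C> \<noteq> {}" "finite \<C>" using assms(1) unfolding box_cover_def by auto
  then show ?thesis using \<C>(2) by (metis One_nat_def Suc_leI card_gt_0_iff)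
qed

lemma box_number_change_of_scale:
  fixes F :: "(real ^ 'n::{finite,linorder}) set"
  assumes F: "bounded F" and \<delta>: "\<delta> \<in> Delta" and \<delta>': "\<delta>' \<in> Delta"
  shows "real (box_number F \<delta>) \<le>
    (\<Prod>i\<in>UNIV. 2 * max 1 (\<delta>' $ i / \<delta> $ i)) * real (box_number F \<delta>')"
proof -
  define M where "M = (\<Prod>i\<in>UNIV. 2 * max 1 (\<delta>' $ i / \<delta> $ i))"
  obtain \<C> where \<C>: "box_cover F \<delta>' \<C>" "card \<C> = box_number F \<delta>'"
    using minimal_box_cover[OF F \<delta>'] .
  have \<delta>pos: "0 < \<delta> $ i" for i using \<delta> by (simp add: Delta_def)
  have "\<exists>\<D>. finite \<D> \<and> B \<subseteq> \<Union>\<D> \<and> (\<forall>B'\<in>\<D>. is_open_box \<delta> B') \<and> real (card \<D>) \<le> M"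
    if B: "B \<in> \<C>" for B
  proof -
    obtain l where l: "is_open_box l B" "\<And>i. l $ i \<le> \<delta>' $ i"
      using \<C>(1) B unfolding box_cover_def by blast
    obtain \<D> where \<D>: "finite \<D>" "B \<subseteq> \<Union>\<D>" "\<forall>B'\<in>\<D>. is_open_box \<delta> B'"
      "real (card \<D>) \<le> (\<Prod>i\<in>UNIV. 2 * max 1 (l $ i / \<delta> $ i))"
      using open_box_subdivision[OF l(1) \<delta>] .
    have "l $ i / \<delta> $ i \<le> \<delta>' $ i / \<delta> $ i" for i
      using l(2)[of i] \<delta>pos[of i] by (simp add: divide_right_mono)
    then have "(\<Prod>i\<in>UNIV. 2 * max 1 (l $ i / \<delta> $ i)) \<le> M"
      unfolding M_def by (intro prod_mono) (auto intro: max.coboundedI2)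
    then show ?thesis using \<D> by (intro exI[of _ \<D>]) auto
  qed
  then obtain D where D: "\<And>B. B \<in> \<C> \<Longrightarrow> finite (D B) \<and> B \<subseteq> \<Union>(D B) \<and>
      (\<forall>B'\<in>D B. is_open_box \<delta> B') \<and> real (card (D B)) \<le> M"
    by metis
  have fin: "finite \<C>" and cov: "F \<subseteq> \<Union>\<C>" using \<C>(1) unfolding box_cover_def by auto
  have "box_cover F \<delta> (\<Union>B\<in>\<C>. D B)"
    unfolding box_cover_def
  proof (intro conjI)
    show "finite (\<Union>B\<in>\<C>. D B)" using fin D by blast
    show "F \<subseteq> \<Union>(\<Union>B\<in>\<C>. D B)" using cov D by blast
    show "\<forall>B\<in>\<Union>B\<in>\<C>. D B. \<exists>l. is_open_box l B \<and> (\<forall>i. l $ i \<le> \<delta> $ i)" using D by blast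
  qed
  then have "real (box_number F \<delta>) \<le> real (card (\<Union>B\<in>\<C>. D B))" by (simp add: box_number_le)
  also have "\<dots> \<le> (\<Sum>B\<in>\<C>. real (card (D B)))"
    using card_UN_le[OF fin, of D] by (metis of_nat_le_iff of_nat_sum)
  also have "\<dots> \<le> (\<Sum>B\<in>\<C>. M)" by (intro sum_mono) (use D in blast)
  also have "\<dots> = M * real (box_number F \<delta>')" using \<C>(2) by simp
  finally show ?thesis unfolding M_def .
qed

lemma exp_scale_in_Delta:
  fixes a :: "real ^ 'n::{finite,linorder}"
  assumes "a \<in> eccentricity_cone"
  shows "exp_scale 1 a \<in> Delta"
  using assms by (auto simp: exp_scale_def Delta_def eccentricity_cone_def)

lemma log_number_nonneg:
  fixes F :: "(real ^ 'n::{finite,linorder}) set"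
  assumes "F \<noteq> {}" "bounded F" "a \<in> eccentricity_cone"
  shows "0 \<le> log_number F a"
  using box_number_ge_1[OF assms(1,2) exp_scale_in_Delta[OF assms(3)]]
  by (simp add: log_number_def)

text \<open>
  This is the change of scale read in logarithms. It contains monotonicity up to a constant (when
  \<open>b \<le> a\<close> the sum vanishes) as well as a Lipschitz bound in the sum norm.
\<close>

lemma log_number_quasi_Lipschitz:
  fixes F :: "(real ^ 'n::{finite,linorder}) set"
  assumes F: "F \<noteq> {}" "bounded F" and a: "a \<in> eccentricity_cone" and b: "b \<in> eccentricity_cone"
  shows "log_number F b \<le>
    log_number F a + real CARD('n) * ln 2 + (\<Sum>i\<in>UNIV. max 0 (b $ i - a $ i))"
proof -
  let ?N = "\<lambda>x. real (box_number F (exp_scale 1 x))"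
  have N: "0 < ?N x" if "x \<in> eccentricity_cone" for x
    using box_number_ge_1[OF F exp_scale_in_Delta[OF that]] by simp
  have factor: "2 * max 1 (exp_scale 1 a $ i / exp_scale 1 b $ i)
      = exp (ln 2 + max 0 (b $ i - a $ i))" for i
  proof -
    have "exp_scale 1 a $ i / exp_scale 1 b $ i = exp (b $ i - a $ i)"
      by (simp add: exp_scale_def flip: exp_diff)
    then show ?thesis by (simp add: exp_add max_def)
  qed
  have "?N b \<le> (\<Prod>i\<in>UNIV. exp (ln 2 + max 0 (b $ i - a $ i))) * ?N a"
    using box_number_change_of_scale[OF F(2) exp_scale_in_Delta[OF b] exp_scale_in_Delta[OF a]]
    unfolding factor .
  also have "\<dots> = exp (real CARD('n) * ln 2 + (\<Sum>i\<in>UNIV. max 0 (b $ i - a $ i))) * ?N a"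
    by (simp add: exp_sum[symmetric] sum.distrib)
  finally have "ln (?N b) \<le>
      ln (exp (real CARD('n) * ln 2 + (\<Sum>i\<in>UNIV. max 0 (b $ i - a $ i))) * ?N a)"
    using N[OF b] N[OF a] by (subst ln_le_cancel_iff) auto
  also have "\<dots> = real CARD('n) * ln 2 + (\<Sum>i\<in>UNIV. max 0 (b $ i - a $ i)) + ln (?N a)"
    using N[OF a] by (subst ln_mult) auto
  finally show ?thesis by (simp add: log_number_def)
qed

section \<open>The cone and the lower profile\<close>

lemma cone_scaleR:
  "a \<in> eccentricity_cone \<Longrightarrow> 0 < t \<Longrightarrow> t *\<^sub>R a \<in> eccentricity_cone"
  by (auto simp: eccentricity_cone_def)

lemma cone_add:
  "a \<in> eccentricity_cone \<Longrightarrow> b \<in> eccentricity_cone \<Longrightarrow> a + b \<in> eccentricity_cone"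
  by (auto simp: eccentricity_cone_def intro: add_mono add_pos_pos)

lemma cone_const: "0 < t \<Longrightarrow> (\<chi> i. t) \<in> eccentricity_cone"
  by (simp add: eccentricity_cone_def)

lemma lower_profile_alt:
  "lower_profile F a = Liminf at_top (\<lambda>t. ereal (log_number F (t *\<^sub>R a) / t))"
  by (simp add: lower_profile_def log_number_def exp_scale_def)

lemma lower_profile_homogeneous:
  fixes a :: "real ^ 'n::{finite,linorder}"
  assumes s: "0 < s"
  shows "lower_profile F (s *\<^sub>R a) = ereal s * lower_profile F a"
proof -
  let ?g = "\<lambda>t. ereal (log_number F (t *\<^sub>R a) / t)"
  have "lower_profile F (s *\<^sub>R a) = Liminf at_top (\<lambda>t. ereal s * ?g (s * t))"
    unfolding lower_profile_alt
    using s by (intro Liminf_eq eventually_mono[OF eventually_gt_at_top[of 0]])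
      (simp add: mult.commute)
  also have "\<dots> = ereal s * Liminf at_top (\<lambda>t. ?g (s * t))"
    by (rule Liminf_ereal_mult_left) (use s in auto)
  also have "Liminf at_top (\<lambda>t. ?g (s * t)) = Liminf (filtermap ((*) s) at_top) ?g"
    using s by (intro Liminf_filtermap_eq[symmetric]) (auto simp: inj_on_def)
  also have "filtermap ((*) s) at_top = at_top"
    by (rule filtermap_fun_inverse[where g = "\<lambda>t. t / s"])
      (use s in \<open>auto intro!: filterlim_tendsto_pos_mult_at_top[OF tendsto_const _ filterlim_ident]
          simp: divide_inverse_commute\<close>)
  finally show ?thesis unfolding lower_profile_alt .
qed

lemma lower_profile_nonneg:
  fixes F :: "(real ^ 'n::{finite,linorder}) set"
  assumes F: "F \<noteq> {}" "bounded F" and a: "a \<in> eccentricity_cone"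
  shows "0 \<le> lower_profile F a"
  unfolding lower_profile_alt
proof (rule Liminf_bounded)
  show "\<forall>\<^sub>F t in at_top. 0 \<le> ereal (log_number F (t *\<^sub>R a) / t)"
    using eventually_gt_at_top[of 0]
    by eventually_elim (simp add: log_number_nonneg[OF F cone_scaleR[OF a]])
qed

lemma lower_profile_mono:
  fixes F :: "(real ^ 'n::{finite,linorder}) set"
  assumes F: "F \<noteq> {}" "bounded F" and a: "a \<in> eccentricity_cone" and b: "b \<in> eccentricity_cone"
    and le: "\<And>i. a $ i \<le> b $ i"
  shows "lower_profile F a \<le> lower_profile F b"
  unfolding lower_profile_alt[of F b] le_Liminf_iff
proof (intro allI impI)
  fix y assume "y < lower_profile F a"
  then obtain r where r: "y < ereal r" "ereal r < lower_profile F a"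
    using ereal_dense2 by blast
  then obtain q where q: "ereal r < ereal q" "ereal q < lower_profile F a"
    using ereal_dense2 by blast
  let ?D = "real CARD('n) * ln 2"
  have "((\<lambda>t. ?D / t) \<longlongrightarrow> 0) at_top"
    by (rule tendsto_divide_0[OF tendsto_const filterlim_at_top_imp_at_infinity[OF filterlim_ident]])
  then have "\<forall>\<^sub>F t in at_top. ?D / t < q - r"
    by (rule order_tendstoD) (use q in simp)
  moreover have "\<forall>\<^sub>F t in at_top. ereal q < ereal (log_number F (t *\<^sub>R a) / t)"
    using q(2) unfolding lower_profile_alt by (rule less_LiminfD)
  ultimately show "\<forall>\<^sub>F t in at_top. y < ereal (log_number F (t *\<^sub>R b) / t)"
    using eventually_gt_at_top[of 0]
  proof eventually_elim
    case (elim t)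
    have "log_number F (t *\<^sub>R a) \<le> log_number F (t *\<^sub>R b) + ?D
        + (\<Sum>i\<in>UNIV. max 0 ((t *\<^sub>R a) $ i - (t *\<^sub>R b) $ i))"
      by (rule log_number_quasi_Lipschitz[OF F]) (use a b elim cone_scaleR in auto)
    also have "(\<Sum>i\<in>UNIV. max 0 ((t *\<^sub>R a) $ i - (t *\<^sub>R b) $ i)) = 0"
      using elim le by (intro sum.neutral) (auto simp: max_def intro: antisym)
    finally have "log_number F (t *\<^sub>R a) / t \<le> log_number F (t *\<^sub>R b) / t + ?D / t"
      using elim by (simp add: field_simps)
    then have "r < log_number F (t *\<^sub>R b) / t" using elim by simp
    then show ?case using r(1) by (meson ereal_less_eq(3) less_le_trans less_imp_le)
  qed
qed

text \<open>
  Comparison of \<open>t a\<close> with the fixed scale \<open>(1, \<dots>, 1)\<close> shows that \<open>L (t a) / t\<close> is at most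
  \<open>\<Sum>\<^sub>i a\<^sub>i\<close> up to a vanishing error.
\<close>

lemma lower_profile_finite:
  fixes F :: "(real ^ 'n::{finite,linorder}) set"
  assumes F: "F \<noteq> {}" "bounded F" and a: "a \<in> eccentricity_cone"
  shows "\<bar>lower_profile F a\<bar> \<noteq> \<infinity>"
proof -
  let ?S = "\<Sum>i\<in>UNIV. a $ i"
  define e :: "real ^ 'n::{finite,linorder}" where "e = (\<chi> i. 1)"
  have e: "e \<in> eccentricity_cone" unfolding e_def by (simp add: cone_const)
  define C where "C = log_number F e + real CARD('n) * ln 2"
  have "lower_profile F a \<le> ereal (?S + 1)"
  proof (rule ccontr)
    assume "\<not> ?thesis"
    then have "\<forall>\<^sub>F t in at_top. ereal (?S + 1) < ereal (log_number F (t *\<^sub>R a) / t)"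
      unfolding lower_profile_alt by (intro less_LiminfD) simp
    moreover have "((\<lambda>t. C / t) \<longlongrightarrow> 0) at_top"
      by (rule tendsto_divide_0[OF tendsto_const filterlim_at_top_imp_at_infinity[OF filterlim_ident]])
    then have "\<forall>\<^sub>F t in at_top. C / t < 1"
      by (rule order_tendstoD) simp
    ultimately have "\<forall>\<^sub>F t::real in at_top. False"
      using eventually_gt_at_top[of 0]
    proof eventually_elim
      case (elim t)
      have "log_number F (t *\<^sub>R a) \<le> C + (\<Sum>i\<in>UNIV. max 0 ((t *\<^sub>R a) $ i - e $ i))"
        unfolding C_def
        by (rule log_number_quasi_Lipschitz[OF F]) (use a e elim cone_scaleR in auto)
      also have "(\<Sum>i\<in>UNIV. max 0 ((t *\<^sub>R a) $ i - e $ i)) \<le> (\<Sum>i\<in>UNIV. t * a $ i)"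
        by (intro sum_mono) (use a elim in \<open>auto simp: eccentricity_cone_def e_def less_imp_le\<close>)
      also have "\<dots> = t * ?S" by (simp add: sum_distrib_left)
      finally have "log_number F (t *\<^sub>R a) / t \<le> C / t + ?S" using elim by (simp add: field_simps)
      then show False using elim by simp
    qed
    then show False by simp
  qed
  then show ?thesis using lower_profile_nonneg[OF F a] by auto
qed

section \<open>The lower print in logarithmic scales\<close>

text \<open>
  The substitution \<open>\<delta> = e\<^sup>-\<^sup>a\<close> is a bijection from the cone onto the admissible scales, and it turns
  \<open>\<delta>\<^sub>1 \<down> 0\<close> into \<open>a\<^sub>1 \<rightarrow> \<infinity>\<close>.
\<close>

lemma eventually_Delta_filter:
  fixes P :: "real ^ 'n::{finite,linorder} \<Rightarrow> bool"
  shows "eventually P Delta_filter \<longleftrightarrow>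
    (\<exists>T. \<forall>a\<in>eccentricity_cone. T < a $ Min UNIV \<longrightarrow> P (exp_scale 1 a))"
proof -
  let ?m = "Min UNIV :: 'n"
  have ev: "eventually P Delta_filter \<longleftrightarrow> (\<exists>\<epsilon>>0. \<forall>\<delta>\<in>Delta. \<delta> $ ?m < \<epsilon> \<longrightarrow> P \<delta>)"
  proof
    assume "eventually P Delta_filter"
    then obtain Q where Q: "eventually Q (at_right (0::real))"
        "\<And>\<delta>. Q (\<delta> $ ?m) \<Longrightarrow> \<delta> \<in> Delta \<Longrightarrow> P \<delta>"
      unfolding Delta_filter_def eventually_inf_principal eventually_filtercomap by blast
    then obtain \<epsilon> where "\<epsilon> > 0" "\<And>y. y > 0 \<Longrightarrow> y < \<epsilon> \<Longrightarrow> Q y"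
      unfolding eventually_at_right_field by blast
    then show "\<exists>\<epsilon>>0. \<forall>\<delta>\<in>Delta. \<delta> $ ?m < \<epsilon> \<longrightarrow> P \<delta>"
      using Q(2) by (intro exI[of _ \<epsilon>]) (auto simp: Delta_def)
  next
    assume "\<exists>\<epsilon>>0. \<forall>\<delta>\<in>Delta. \<delta> $ ?m < \<epsilon> \<longrightarrow> P \<delta>"
    then obtain \<epsilon> where \<epsilon>: "\<epsilon> > 0" "\<forall>\<delta>\<in>Delta. \<delta> $ ?m < \<epsilon> \<longrightarrow> P \<delta>" by blast
    have "eventually (\<lambda>y. y < \<epsilon>) (at_right (0::real))"
      using \<epsilon>(1) unfolding eventually_at_right_field by blast
    then show "eventually P Delta_filter"
      unfolding Delta_filter_def eventually_inf_principal eventually_filtercomap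
      using \<epsilon>(2) by blast
  qed
  have exp_nth: "exp_scale 1 a $ ?m = exp (- (a $ ?m))" for a :: "real ^ 'n::{finite,linorder}"
    by (simp add: exp_scale_def)
  show ?thesis
    unfolding ev
  proof
    assume "\<exists>\<epsilon>>0. \<forall>\<delta>\<in>Delta. \<delta> $ ?m < \<epsilon> \<longrightarrow> P \<delta>"
    then obtain \<epsilon> where \<epsilon>: "\<epsilon> > 0" "\<forall>\<delta>\<in>Delta. \<delta> $ ?m < \<epsilon> \<longrightarrow> P \<delta>" by blast
    have "P (exp_scale 1 a)" if "a \<in> eccentricity_cone" "- ln \<epsilon> < a $ ?m" for a
    proof -
      have "exp (- (a $ ?m)) < exp (ln \<epsilon>)" using that by simp
      then show ?thesis using \<epsilon> exp_scale_in_Delta[OF that(1)] by (simp add: exp_nth)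
    qed
    then show "\<exists>T. \<forall>a\<in>eccentricity_cone. T < a $ ?m \<longrightarrow> P (exp_scale 1 a)" by blast
  next
    assume "\<exists>T. \<forall>a\<in>eccentricity_cone. T < a $ ?m \<longrightarrow> P (exp_scale 1 a)"
    then obtain T where T: "\<forall>a\<in>eccentricity_cone. T < a $ ?m \<longrightarrow> P (exp_scale 1 a)" by blast
    have "P \<delta>" if \<delta>: "\<delta> \<in> Delta" "\<delta> $ ?m < exp (- T)" for \<delta>
    proof -
      define a :: "real ^ 'n::{finite,linorder}" where "a = (\<chi> i. - ln (\<delta> $ i))"
      have pos: "0 < \<delta> $ i" for i using \<delta> by (simp add: Delta_def)
      have "a \<in> eccentricity_cone"
        using \<delta>(1) by (auto simp: a_def eccentricity_cone_def Delta_def)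
      moreover have "ln (\<delta> $ ?m) < ln (exp (- T))"
        using \<delta>(2) pos by (subst ln_less_cancel_iff) auto
      then have "T < a $ ?m" by (simp add: a_def)
      moreover have "exp_scale 1 a = \<delta>"
        using pos by (simp add: vec_eq_iff exp_scale_def a_def)
      ultimately show ?thesis using T by metis
    qed
    then show "\<exists>\<epsilon>>0. \<forall>\<delta>\<in>Delta. \<delta> $ ?m < \<epsilon> \<longrightarrow> P \<delta>" by (intro exI[of _ "exp (- T)"]) auto
  qed
qed

lemma multi_powr_exp_scale: "multi_powr (exp_scale 1 a) \<alpha> = exp (- (\<alpha> \<bullet> a))"
  by (simp add: multi_powr_def exp_scale_def powr_def inner_vec_def exp_sum[symmetric] sum_negf)

lemma lower_print_iff:
  fixes F :: "(real ^ 'n::{finite,linorder}) set"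
  assumes F: "F \<noteq> {}" "bounded F"
  shows "\<alpha> \<in> lower_print F \<longleftrightarrow> \<alpha> \<in> nonneg_orthant \<and>
    (\<exists>M T. \<forall>a\<in>eccentricity_cone. T < a $ Min UNIV \<longrightarrow> \<alpha> \<bullet> a \<le> log_number F a + M)"
proof -
  let ?f = "\<lambda>\<delta>. real (box_number F \<delta>) * multi_powr \<delta> \<alpha>"
  have f: "?f (exp_scale 1 a) = exp (log_number F a - \<alpha> \<bullet> a)" if "a \<in> eccentricity_cone" for a
    using box_number_ge_1[OF F exp_scale_in_Delta[OF that]]
    by (simp add: multi_powr_exp_scale log_number_def exp_diff exp_minus divide_inverse)
  have "0 < Liminf Delta_filter (\<lambda>\<delta>. ereal (?f \<delta>)) \<longleftrightarrow>
    (\<exists>M T. \<forall>a\<in>eccentricity_cone. T < a $ Min UNIV \<longrightarrow> \<alpha> \<bullet> a \<le> log_number F a + M)"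
  proof
    assume "0 < Liminf Delta_filter (\<lambda>\<delta>. ereal (?f \<delta>))"
    then obtain c where c: "0 < ereal c" "ereal c < Liminf Delta_filter (\<lambda>\<delta>. ereal (?f \<delta>))"
      using ereal_dense2 by blast
    then obtain T where T: "\<And>a. a \<in> eccentricity_cone \<Longrightarrow> T < a $ Min UNIV \<Longrightarrow>
        ereal c < ereal (?f (exp_scale 1 a))"
      using less_LiminfD[OF c(2)] unfolding eventually_Delta_filter by blast
    have "\<alpha> \<bullet> a \<le> log_number F a + - ln c"
      if a: "a \<in> eccentricity_cone" "T < a $ Min UNIV" for a
    proof -
      have "ln c < ln (exp (log_number F a - \<alpha> \<bullet> a))"
        using T[OF a] c(1) unfolding f[OF a(1)] by (subst ln_less_cancel_iff) auto
      then show ?thesis by simp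
    qed
    then show "\<exists>M T. \<forall>a\<in>eccentricity_cone. T < a $ Min UNIV \<longrightarrow> \<alpha> \<bullet> a \<le> log_number F a + M"
      by blast
  next
    assume "\<exists>M T. \<forall>a\<in>eccentricity_cone. T < a $ Min UNIV \<longrightarrow> \<alpha> \<bullet> a \<le> log_number F a + M"
    then obtain M T where
      "\<forall>a\<in>eccentricity_cone. T < a $ Min UNIV \<longrightarrow> \<alpha> \<bullet> a \<le> log_number F a + M" by blast
    then have "\<forall>a\<in>eccentricity_cone. T < a $ Min UNIV \<longrightarrow>
        ereal (exp (- M)) \<le> ereal (?f (exp_scale 1 a))"
      using f by (auto simp: algebra_simps)
    then have "\<forall>\<^sub>F \<delta> in Delta_filter. ereal (exp (- M)) \<le> ereal (?f \<delta>)"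
      unfolding eventually_Delta_filter by blast
    then have "ereal (exp (- M)) \<le> Liminf Delta_filter (\<lambda>\<delta>. ereal (?f \<delta>))"
      by (rule Liminf_bounded)
    then show "0 < Liminf Delta_filter (\<lambda>\<delta>. ereal (?f \<delta>))"
      by (rule less_le_trans[rotated]) simp
  qed
  then show ?thesis by (simp add: lower_print_def)
qed

section \<open>The lower print fills the profile body up to scaling\<close>

text \<open>A ray through the cone eventually enters every region \<open>a\<^sub>1 > T\<close>, so the uniform bound restricts to it.\<close>

lemma lower_print_subset_profile_body:
  fixes F :: "(real ^ 'n::{finite,linorder}) set"
  assumes F: "F \<noteq> {}" "bounded F"
  shows "lower_print F \<subseteq> profile_body F"
proof
  fix \<alpha> assume \<alpha>: "\<alpha> \<in> lower_print F"
  then obtain M T where MT: "\<And>a. a \<in> eccentricity_cone \<Longrightarrow> T < a $ Min UNIV \<Longrightarrow>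
      \<alpha> \<bullet> a \<le> log_number F a + M"
    and nn: "\<alpha> \<in> nonneg_orthant"
    using lower_print_iff[OF F] by blast
  have "ereal (\<alpha> \<bullet> a) \<le> lower_profile F a" if a: "a \<in> eccentricity_cone" for a
    unfolding lower_profile_alt le_Liminf_iff
  proof (intro allI impI)
    fix y assume "y < ereal (\<alpha> \<bullet> a)"
    then obtain q where q: "y < ereal q" "ereal q < ereal (\<alpha> \<bullet> a)"
      using ereal_dense2 by blast
    have "((\<lambda>t. M / t) \<longlongrightarrow> 0) at_top"
      by (rule tendsto_divide_0[OF tendsto_const filterlim_at_top_imp_at_infinity[OF filterlim_ident]])
    then have "\<forall>\<^sub>F t in at_top. M / t < \<alpha> \<bullet> a - q"
      by (rule order_tendstoD) (use q in simp)
    moreover have "\<forall>\<^sub>F t in at_top. T / a $ Min UNIV < t" by (rule eventually_gt_at_top)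
    ultimately show "\<forall>\<^sub>F t in at_top. y < ereal (log_number F (t *\<^sub>R a) / t)"
      using eventually_gt_at_top[of 0]
    proof eventually_elim
      case (elim t)
      have "0 < a $ Min UNIV" using a by (simp add: eccentricity_cone_def)
      then have "T < (t *\<^sub>R a) $ Min UNIV" using elim by (simp add: field_simps)
      then have "t * (\<alpha> \<bullet> a) \<le> log_number F (t *\<^sub>R a) + M"
        using MT[OF cone_scaleR[OF a]] elim by simp
      then have "\<alpha> \<bullet> a \<le> log_number F (t *\<^sub>R a) / t + M / t"
        using elim by (simp add: field_simps)
      then have "q < log_number F (t *\<^sub>R a) / t" using elim by simp
      then show ?case using q(1) by (meson ereal_less_eq(3) less_le_trans less_imp_le)
    qed
  qed
  then show "\<alpha> \<in> profile_body F" using nn by (simp add: profile_body_def)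
qed

text \<open>
  If \<open>s \<alpha>\<close> is not in the print, there are \<open>A\<^sub>k\<close> in the cone with first coordinate tending to infinity
  and \<open>L A\<^sub>k < s (\<alpha> \<bullet> A\<^sub>k)\<close>. A subsequence of the normalised vectors converges to some \<open>\<beta>\<close>, and the bound for
  the ray through \<open>\<beta>\<close> gives \<open>\<alpha> \<bullet> \<beta> \<le> s (\<alpha> \<bullet> \<beta>)\<close>, which is absurd once \<open>\<alpha> \<bullet> \<beta> > 0\<close>.

  Two things can go wrong at the boundary of the cone. If \<open>A\<^sub>k\<close> is normalised by its norm, the limit may
  be orthogonal to \<open>\<alpha>\<close>. Therefore the coordinates of \<open>A\<^sub>k\<close> are first truncated at the level of the last
  index \<open>j\<close> with \<open>\<alpha>\<^sub>j > 0\<close>, which alters neither \<open>\<alpha> \<bullet> A\<^sub>k\<close> nor, except by a constant, the upper bound for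
  \<open>L\<close>; division by the \<open>j\<close>-th coordinate then forces \<open>\<beta>\<^sub>j = 1\<close>. Moreover \<open>\<beta>\<close> may have vanishing
  coordinates, where nothing is known about the profile. It is replaced by \<open>max \<beta> \<eta>\<close>, at
  a cost of at most \<open>n \<eta>\<close>.
\<close>

lemma scaled_profile_body_in_lower_print:
  fixes F :: "(real ^ 'n::{finite,linorder}) set"
  assumes F: "F \<noteq> {}" "bounded F" and \<alpha>: "\<alpha> \<in> profile_body F" and s: "0 \<le> s" "s < 1"
  shows "s *\<^sub>R \<alpha> \<in> lower_print F"
proof (cases "\<alpha> = 0")
  case True
  then show ?thesis
    using log_number_nonneg[OF F]
    by (auto simp: lower_print_iff[OF F] nonneg_orthant_def intro!: exI[of _ 0])
next
  case False
  let ?D = "real CARD('n) * ln 2"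
  have "\<alpha> \<in> nonneg_orthant"
    using \<alpha> cone_const[OF zero_less_one] unfolding profile_body_def by blast
  then have nn: "0 \<le> \<alpha> $ i" for i by (simp add: nonneg_orthant_def)
  define j where "j = Max {i. \<alpha> $ i \<noteq> 0}"
  have ne: "{i. \<alpha> $ i \<noteq> 0} \<noteq> {}" using False by (auto simp: vec_eq_iff)
  have "j \<in> {i. \<alpha> $ i \<noteq> 0}" unfolding j_def using ne by (intro Max_in) auto
  then have \<alpha>j: "0 < \<alpha> $ j" using nn[of j] by auto
  have \<alpha>0: "\<alpha> $ i = 0" if "j < i" for i
    using that Max_ge[of "{i. \<alpha> $ i \<noteq> 0}" i] unfolding j_def by fastforce
  show ?thesis
  proof (rule ccontr)
    assume "s *\<^sub>R \<alpha> \<notin> lower_print F"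
    moreover have "s *\<^sub>R \<alpha> \<in> nonneg_orthant" using nn s by (simp add: nonneg_orthant_def)
    ultimately have "\<exists>a\<in>eccentricity_cone. T < a $ Min UNIV \<and>
        log_number F a < (s *\<^sub>R \<alpha>) \<bullet> a" for T
      unfolding lower_print_iff[OF F] by (metis add.right_neutral not_le)
    then have "\<exists>a. a \<in> eccentricity_cone \<and> real k < a $ Min UNIV \<and>
        log_number F a < s * (\<alpha> \<bullet> a)" for k
      by (metis inner_scaleR_left)
    then obtain A where A: "\<And>k. A k \<in> eccentricity_cone" "\<And>k. real k < A k $ Min UNIV"
        "\<And>k. log_number F (A k) < s * (\<alpha> \<bullet> A k)"
      by metis
    define T where "T k = A k $ j" for k
    have T_gt: "real k < T k" for k
    proof -
      have "A k $ Min UNIV \<le> A k $ j" using A(1)[of k] by (simp add: eccentricity_cone_def)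
      then show ?thesis using A(2)[of k] by (simp add: T_def)
    qed
    then have Tpos: "0 < T k" for k by (meson le_less_trans of_nat_0_le_iff)
    have T_lim: "filterlim T at_top sequentially"
      by (rule filterlim_at_top_mono[OF filterlim_real_sequentially])
        (use T_gt less_imp_le in \<open>auto intro: always_eventually\<close>)
    define b :: "nat \<Rightarrow> real ^ 'n::{finite,linorder}" where "b k = (\<chi> i. min (A k $ i) (T k) / T k)" for k
    have Apos: "0 < A k $ i" for k i using A(1)[of k] by (simp add: eccentricity_cone_def)
    have Amono: "A k $ i \<le> A k $ i'" if "i \<le> i'" for k i i'
      using A(1)[of k] that by (simp add: eccentricity_cone_def)
    have b_bounds: "0 < b k $ i" "b k $ i \<le> 1" for k i
      using Apos[of k i] Tpos[of k] by (auto simp: b_def min_def)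
    have b_mono: "b k $ i \<le> b k $ i'" if "i \<le> i'" for k i i'
      using Amono[OF that, of k] Tpos[of k]
      by (auto simp: b_def intro!: divide_right_mono min.mono)
    have bj: "b k $ j = 1" for k using Tpos[of k] by (simp add: b_def T_def)
    have bK: "b k \<in> eccentricity_cone" for k
      using b_bounds b_mono by (simp add: eccentricity_cone_def)
    have inner_b: "\<alpha> \<bullet> A k = T k * (\<alpha> \<bullet> b k)" for k
    proof -
      have summand: "\<alpha> $ i * A k $ i = T k * (\<alpha> $ i * b k $ i)" for i
      proof (cases "i \<le> j")
        case True
        then have "min (A k $ i) (T k) = A k $ i" using Amono[of i j k] by (simp add: T_def)
        then show ?thesis using Tpos[of k] by (simp add: b_def)
      qed (simp add: \<alpha>0)
      show ?thesis by (simp only: inner_vec_def inner_real_def sum_distrib_left summand)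
    qed
    have Lb: "log_number F (T k *\<^sub>R b k) \<le> T k * (s * (\<alpha> \<bullet> b k)) + ?D" for k
    proof -
      have "log_number F (T k *\<^sub>R b k) \<le> log_number F (A k) + ?D
          + (\<Sum>i\<in>UNIV. max 0 ((T k *\<^sub>R b k) $ i - A k $ i))"
        by (rule log_number_quasi_Lipschitz[OF F A(1) cone_scaleR[OF bK Tpos]])
      also have "(\<Sum>i\<in>UNIV. max 0 ((T k *\<^sub>R b k) $ i - A k $ i)) = 0"
        using Tpos[of k] by (intro sum.neutral) (auto simp: b_def)
      finally show ?thesis using A(3)[of k] unfolding inner_b by (simp add: mult_ac)
    qed
    have "b k \<in> cbox 0 (\<chi> i. 1)" for k
      using b_bounds by (simp add: mem_box_cart less_imp_le)
    then have "bounded (range b)" by (intro bounded_subset[OF bounded_cbox] image_subsetI)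
    then obtain \<beta> r where r: "strict_mono r" and lim: "(b \<circ> r) \<longlonglongrightarrow> \<beta>"
      using bounded_imp_convergent_subsequence by blast
    have lim_i: "(\<lambda>k. b (r k) $ i) \<longlonglongrightarrow> \<beta> $ i" for i
      using tendsto_vec_nth[OF lim] by (simp add: o_def)
    have \<beta>j: "\<beta> $ j = 1" using lim_i[of j] by (simp add: bj LIMSEQ_const_iff)
    have \<beta>0: "0 \<le> \<beta> $ i" for i
      by (rule tendsto_lowerbound[OF lim_i]) (simp_all add: always_eventually b_bounds less_imp_le)
    have \<beta>mono: "\<beta> $ i \<le> \<beta> $ i'" if "i \<le> i'" for i i'
      by (rule tendsto_le[OF _ lim_i lim_i]) (use b_mono[OF that] in auto)
    have Tr: "filterlim (\<lambda>k. T (r k)) at_top sequentially"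
      using filterlim_compose[OF T_lim filterlim_subseq[OF r]] .
    have key: "\<alpha> \<bullet> \<beta> \<le> s * (\<alpha> \<bullet> \<beta>) + real CARD('n) * \<eta>" if \<eta>: "0 < \<eta>" for \<eta>
    proof (rule dense_le)
      fix q assume q: "q < \<alpha> \<bullet> \<beta>"
      define c :: "real ^ 'n::{finite,linorder}" where "c = (\<chi> i. max (\<beta> $ i) \<eta>)"
      have c: "c \<in> eccentricity_cone"
        using \<eta> \<beta>mono by (auto simp: c_def eccentricity_cone_def less_max_iff_disj
            intro: max.coboundedI1)
      have "\<alpha> \<bullet> \<beta> \<le> \<alpha> \<bullet> c"
        unfolding inner_vec_def by (intro sum_mono) (auto simp: c_def intro!: mult_left_mono nn)
      with q have "ereal q < ereal (\<alpha> \<bullet> c)" by simp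
      also have "\<dots> \<le> lower_profile F c" using \<alpha> c by (auto simp: profile_body_def)
      finally have "ereal q < lower_profile F c" .
      then have "\<forall>\<^sub>F t in at_top. ereal q < ereal (log_number F (t *\<^sub>R c) / t)"
        unfolding lower_profile_alt by (rule less_LiminfD)
      then have low: "\<forall>\<^sub>F k in sequentially.
          ereal q < ereal (log_number F (T (r k) *\<^sub>R c) / T (r k))"
        using Tr by (rule eventually_compose_filterlim)
      define R where "R k = s * (\<alpha> \<bullet> b (r k)) + 2 * ?D / T (r k)
          + (\<Sum>i\<in>UNIV. max 0 (c $ i - b (r k) $ i))" for k
      have up: "log_number F (T k *\<^sub>R c) / T k \<le>
          s * (\<alpha> \<bullet> b k) + 2 * ?D / T k + (\<Sum>i\<in>UNIV. max 0 (c $ i - b k $ i))" for k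
      proof -
        have "log_number F (T k *\<^sub>R c) \<le> log_number F (T k *\<^sub>R b k) + ?D
            + (\<Sum>i\<in>UNIV. max 0 ((T k *\<^sub>R c) $ i - (T k *\<^sub>R b k) $ i))"
          by (rule log_number_quasi_Lipschitz[OF F]) (use bK c Tpos cone_scaleR in auto)
        also have "(\<Sum>i\<in>UNIV. max 0 ((T k *\<^sub>R c) $ i - (T k *\<^sub>R b k) $ i))
            = T k * (\<Sum>i\<in>UNIV. max 0 (c $ i - b k $ i))"
          unfolding sum_distrib_left using Tpos[of k]
          by (intro sum.cong) (auto simp: max_def right_diff_distrib mult_le_cancel_left)
        finally have "log_number F (T k *\<^sub>R c) \<le> T k * (s * (\<alpha> \<bullet> b k)) + 2 * ?D
            + T k * (\<Sum>i\<in>UNIV. max 0 (c $ i - b k $ i))"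
          using Lb[of k] by simp
        then show ?thesis using Tpos[of k] by (simp add: field_simps)
      qed
      have "R \<longlonglongrightarrow> s * (\<alpha> \<bullet> \<beta>) + 0 + (\<Sum>i\<in>UNIV. max 0 (c $ i - \<beta> $ i))"
        unfolding R_def
      proof (intro tendsto_intros)
        show "(\<lambda>k. 2 * ?D / T (r k)) \<longlonglongrightarrow> 0"
          by (rule tendsto_divide_0[OF tendsto_const filterlim_at_top_imp_at_infinity[OF Tr]])
      qed (use lim in \<open>simp_all add: o_def\<close>)
      then have "q \<le> s * (\<alpha> \<bullet> \<beta>) + 0 + (\<Sum>i\<in>UNIV. max 0 (c $ i - \<beta> $ i))"
      proof (rule tendsto_lowerbound)
        show "\<forall>\<^sub>F k in sequentially. q \<le> R k"
          using low
        proof eventually_elim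
          case (elim k)
          then show ?case using up[of "r k"] by (simp add: R_def)
        qed
      qed simp
      also have "(\<Sum>i\<in>UNIV. max 0 (c $ i - \<beta> $ i)) \<le> (\<Sum>i\<in>(UNIV::'n set). \<eta>)"
        by (intro sum_mono) (use \<beta>0 \<eta> in \<open>auto simp: c_def max_def\<close>)
      finally show "q \<le> s * (\<alpha> \<bullet> \<beta>) + real CARD('n) * \<eta>" by simp
    qed
    have "\<alpha> \<bullet> \<beta> \<le> s * (\<alpha> \<bullet> \<beta>)"
    proof (rule field_le_epsilon)
      fix e :: real assume "0 < e"
      then show "\<alpha> \<bullet> \<beta> \<le> s * (\<alpha> \<bullet> \<beta>) + e"
        using key[of "e / real CARD('n)"] by simp
    qed
    moreover have "\<alpha> $ j * \<beta> $ j \<le> \<alpha> \<bullet> \<beta>"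
      unfolding inner_vec_def using nn \<beta>0
      by (simp only: inner_real_def, intro member_le_sum) auto
    then have "0 < \<alpha> \<bullet> \<beta>" using \<alpha>j by (simp add: \<beta>j)
    ultimately show False using s(2) by (simp add: mult_le_cancel_right1)
  qed
qed

section \<open>Support functions\<close>

text \<open>
  The constraint of the single vector \<open>(1, \<dots>, 1)\<close> already bounds all coordinates of a non-negative
  vector.
\<close>

lemma compact_profile_body:
  fixes F :: "(real ^ 'n::{finite,linorder}) set"
  assumes F: "F \<noteq> {}" "bounded F"
  shows "compact (profile_body F)"
proof -
  define e :: "real ^ 'n::{finite,linorder}" where "e = (\<chi> i. 1)"
  have e: "e \<in> eccentricity_cone" unfolding e_def by (simp add: cone_const)
  obtain R where R: "lower_profile F e = ereal R" using lower_profile_finite[OF F e] by auto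
  have "profile_body F \<subseteq> cbox 0 (\<chi> i. R)"
  proof
    fix \<alpha> assume "\<alpha> \<in> profile_body F"
    then have nn: "\<And>i. 0 \<le> \<alpha> $ i" and "\<alpha> \<bullet> e \<le> R"
      using e R unfolding profile_body_def nonneg_orthant_def by auto
    then have sum: "(\<Sum>i\<in>UNIV. \<alpha> $ i) \<le> R" by (simp add: inner_vec_def e_def)
    have "\<alpha> $ i \<le> R" for i
      using member_le_sum[of i UNIV "\<lambda>i. \<alpha> $ i"] nn sum by simp
    then show "\<alpha> \<in> cbox 0 (\<chi> i. R)" using nn by (simp add: mem_box_cart)
  qed
  then have "bounded (profile_body F)" using bounded_cbox bounded_subset by blast
  moreover have "closed (profile_body F)"
    unfolding profile_body_def
  proof (intro closed_INT ballI)
    fix a :: "real ^ 'n::{finite,linorder}" assume a: "a \<in> eccentricity_cone"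
    obtain q where q: "lower_profile F a = ereal q" using lower_profile_finite[OF F a] by auto
    have "{\<alpha> \<in> nonneg_orthant. ereal (\<alpha> \<bullet> a) \<le> lower_profile F a}
        = (\<Inter>i. {\<alpha>. 0 \<le> \<alpha> $ i}) \<inter> {\<alpha>. \<alpha> \<bullet> a \<le> q}"
      by (auto simp: nonneg_orthant_def q)
    also have "closed \<dots>"
      by (intro closed_Int closed_INT ballI closed_Collect_le continuous_intros)
    finally show "closed {\<alpha> \<in> nonneg_orthant. ereal (\<alpha> \<bullet> a) \<le> lower_profile F a}" .
  qed
  ultimately show ?thesis by (simp add: compact_eq_bounded_closed)
qed

lemma zero_in_profile_body:
  fixes F :: "(real ^ 'n::{finite,linorder}) set"
  assumes F: "F \<noteq> {}" "bounded F"
  shows "0 \<in> profile_body F"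
  using lower_profile_nonneg[OF F] by (auto simp: profile_body_def nonneg_orthant_def zero_ereal_def)

lemma support_fun_attained:
  assumes "compact K" "K \<noteq> {}"
  obtains \<alpha> where "\<alpha> \<in> K" "support_fun K a = ereal (\<alpha> \<bullet> a)"
proof -
  have "continuous_on K (\<lambda>\<alpha>. \<alpha> \<bullet> a)" by (intro continuous_intros)
  from continuous_attains_sup[OF assms this] obtain \<alpha>
    where \<alpha>: "\<alpha> \<in> K" "\<forall>y\<in>K. y \<bullet> a \<le> \<alpha> \<bullet> a" by blast
  then have "support_fun K a = ereal (\<alpha> \<bullet> a)"
    unfolding support_fun_def by (intro antisym SUP_least SUP_upper2[of \<alpha>]) auto
  then show thesis using that \<alpha>(1) by blast
qed

lemma support_fun_subadditive: "support_fun K (a + b) \<le> support_fun K a + support_fun K b"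
  unfolding support_fun_def
proof (rule SUP_least)
  fix \<alpha> assume \<alpha>: "\<alpha> \<in> K"
  have "ereal (\<alpha> \<bullet> (a + b)) = ereal (\<alpha> \<bullet> a) + ereal (\<alpha> \<bullet> b)" by (simp add: inner_add_right)
  also have "\<dots> \<le> (SUP \<alpha>\<in>K. ereal (\<alpha> \<bullet> a)) + (SUP \<alpha>\<in>K. ereal (\<alpha> \<bullet> b))"
    by (intro add_mono SUP_upper \<alpha>)
  finally show "ereal (\<alpha> \<bullet> (a + b)) \<le> \<dots>" .
qed

text \<open>Letting \<open>s \<up> 1\<close> in \<open>s \<alpha>\<close> recovers every point of the profile body as a limit of points of the print.\<close>

lemma support_fun_lower_print:
  fixes F :: "(real ^ 'n::{finite,linorder}) set"
  assumes F: "F \<noteq> {}" "bounded F"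
  shows "support_fun (lower_print F) a = support_fun (profile_body F) a"
proof (rule antisym)
  show "support_fun (lower_print F) a \<le> support_fun (profile_body F) a"
    unfolding support_fun_def by (rule SUP_subset_mono[OF lower_print_subset_profile_body[OF F]]) simp
  show "support_fun (profile_body F) a \<le> support_fun (lower_print F) a"
    unfolding support_fun_def[of "profile_body F"]
  proof (rule SUP_least)
    fix \<alpha> assume \<alpha>: "\<alpha> \<in> profile_body F"
    have "((\<lambda>s. s * (\<alpha> \<bullet> a)) \<longlongrightarrow> 1 * (\<alpha> \<bullet> a)) (at_left 1)"
      by (intro tendsto_intros)
    then have "((\<lambda>s. ereal (s * (\<alpha> \<bullet> a))) \<longlongrightarrow> ereal (\<alpha> \<bullet> a)) (at_left 1)" by simp
    then show "ereal (\<alpha> \<bullet> a) \<le> support_fun (lower_print F) a"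
    proof (rule tendsto_upperbound)
      show "\<forall>\<^sub>F s in at_left 1. ereal (s * (\<alpha> \<bullet> a)) \<le> support_fun (lower_print F) a"
        using eventually_at_left_real[of 0 "1::real", OF zero_less_one]
      proof eventually_elim
        case (elim s)
        then have "s *\<^sub>R \<alpha> \<in> lower_print F"
          by (intro scaled_profile_body_in_lower_print[OF F \<alpha>]) auto
        then show ?case unfolding support_fun_def by (rule SUP_upper2) simp
      qed
    qed simp
  qed
qed

text \<open>
  A supporting functional of \<open>\<rho>\<close> at \<open>a\<close> which is dominated by \<open>\<rho>\<close> on the cone need not have non-negative
  coordinates if \<open>a\<close> lies on the boundary of the cone. Separation is therefore applied not to the
  epigraph of \<open>\<rho>\<close> but to the larger set \<open>C\<close> of all \<open>(x, r)\<close> with \<open>x \<le> b\<close> and \<open>\<rho> b \<le> r\<close> for some \<open>b\<close> in the cone.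
  Monotonicity of \<open>\<rho>\<close> keeps \<open>C\<close> away from the open vertical half-line below \<open>(a, \<rho> a)\<close>, and the fact that \<open>C\<close> is closed
  under decreasing \<open>x\<close> makes \<open>\<alpha>\<close> non-negative.
\<close>

lemma monotone_sublinear_supporting_vector:
  fixes \<rho> :: "real ^ 'n::{finite,linorder} \<Rightarrow> real"
  assumes hom: "\<And>t a. 0 < t \<Longrightarrow> a \<in> eccentricity_cone \<Longrightarrow> \<rho> (t *\<^sub>R a) = t * \<rho> a"
    and sub: "\<And>a b. a \<in> eccentricity_cone \<Longrightarrow> b \<in> eccentricity_cone \<Longrightarrow> \<rho> (a + b) \<le> \<rho> a + \<rho> b"
    and mono: "\<And>a b. a \<in> eccentricity_cone \<Longrightarrow> b \<in> eccentricity_cone \<Longrightarrow>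
      (\<And>i. a $ i \<le> b $ i) \<Longrightarrow> \<rho> a \<le> \<rho> b"
    and a: "a \<in> eccentricity_cone"
  obtains \<alpha> where "\<alpha> \<in> nonneg_orthant" "\<And>b. b \<in> eccentricity_cone \<Longrightarrow> \<alpha> \<bullet> b \<le> \<rho> b"
    "\<alpha> \<bullet> a = \<rho> a"
proof -
  define C where "C = {(x, r). \<exists>b\<in>eccentricity_cone. (\<forall>i. x $ i \<le> b $ i) \<and> \<rho> b \<le> r}"
  define S where "S = {a} \<times> {..<\<rho> a}"
  have CI: "(x, r) \<in> C" if "b \<in> eccentricity_cone" "\<And>i. x $ i \<le> b $ i" "\<rho> b \<le> r" for x r b
    using that by (auto simp: C_def)
  have C_scale: "t *\<^sub>R z \<in> C" if z: "z \<in> C" and t: "0 < t" for z t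
  proof -
    obtain x r b where "z = (x, r)" "b \<in> eccentricity_cone" "\<forall>i. x $ i \<le> b $ i" "\<rho> b \<le> r"
      using z by (auto simp: C_def)
    then show ?thesis using t hom cone_scaleR by (auto intro!: CI[of "t *\<^sub>R b"])
  qed
  have C_add: "z + z' \<in> C" if z: "z \<in> C" "z' \<in> C" for z z'
  proof -
    obtain x r b where 1: "z = (x, r)" "b \<in> eccentricity_cone" "\<forall>i. x $ i \<le> b $ i" "\<rho> b \<le> r"
      using z by (auto simp: C_def)
    obtain x' r' b' where 2: "z' = (x', r')" "b' \<in> eccentricity_cone" "\<forall>i. x' $ i \<le> b' $ i" "\<rho> b' \<le> r'"
      using z by (auto simp: C_def)
    have "\<rho> (b + b') \<le> r + r'" using sub[of b b'] 1 2 by linarith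
    then show ?thesis using 1 2 by (auto intro!: CI[of "b + b'"] cone_add add_mono)
  qed
  have "convex C"
  proof (rule convexI)
    fix z z' and u v :: real
    assume zz: "z \<in> C" "z' \<in> C" and uv: "0 \<le> u" "0 \<le> v" "u + v = 1"
    consider "u = 0" | "v = 0" | "0 < u" "0 < v" using uv by linarith
    then show "u *\<^sub>R z + v *\<^sub>R z' \<in> C"
      by cases (use zz uv C_scale C_add in auto)
  qed
  moreover have "convex S" unfolding S_def by (intro convex_Times) auto
  moreover have aC: "(a, \<rho> a) \<in> C" by (rule CI[OF a]) auto
  then have "C \<noteq> {}" by blast
  moreover have aS: "(a, \<rho> a - 1) \<in> S" by (simp add: S_def)
  then have "S \<noteq> {}" by blast
  moreover have "S \<inter> C = {}"
    using mono[OF a] by (fastforce simp: S_def C_def)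
  ultimately obtain p d where p: "p \<noteq> 0" and pS: "\<And>z. z \<in> S \<Longrightarrow> p \<bullet> z \<le> d"
    and pC: "\<And>z. z \<in> C \<Longrightarrow> d \<le> p \<bullet> z"
    using separating_hyperplane_sets[of S C] by blast
  obtain \<beta> \<gamma> where p_eq: "p = (\<beta>, \<gamma>)" by fastforce
  have inner_p: "p \<bullet> (x, r) = \<beta> \<bullet> x + \<gamma> * r" for x r by (simp add: p_eq)
  have "0 \<le> \<gamma>"
    using pS[OF aS] pC[OF aC] by (simp add: inner_p algebra_simps)
  (* A vertical hyperplane is impossible, because C projects onto the whole space. *)
  moreover have "\<gamma> \<noteq> 0"
  proof
    assume \<gamma>: "\<gamma> = 0"
    define b :: "real ^ 'n::{finite,linorder}" where "b = (\<chi> i. 1 + norm (a - \<beta>))"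
    have "(a - \<beta>) $ i \<le> b $ i" for i
      using component_le_norm_cart[of "a - \<beta>" i] by (simp add: b_def)
    moreover have "b \<in> eccentricity_cone"
      unfolding b_def by (rule cone_const) (simp add: add_pos_nonneg)
    ultimately have "(a - \<beta>, \<rho> b) \<in> C" by (intro CI) auto
    then have "\<beta> \<bullet> a \<le> \<beta> \<bullet> (a - \<beta>)" using pC pS[OF aS] \<gamma> by (fastforce simp: inner_p)
    then have "\<beta> \<bullet> \<beta> \<le> 0" by (simp add: inner_diff_right)
    then have "\<beta> = 0" by (metis inner_eq_zero_iff inner_ge_zero order_antisym)
    then show False using p by (simp add: p_eq \<gamma> zero_prod_def)
  qed
  ultimately have \<gamma>: "0 < \<gamma>" by simp
  (* A linear functional that is bounded below on a cone is non-negative there. *)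
  have pC0: "0 \<le> p \<bullet> z" if "z \<in> C" for z
  proof (rule ccontr)
    assume "\<not> 0 \<le> p \<bullet> z"
    then have neg: "p \<bullet> z < 0" by simp
    define t where "t = (\<bar>d\<bar> + 1) / - (p \<bullet> z)"
    have "0 < t" unfolding t_def using neg by (intro divide_pos_pos) auto
    then have "d \<le> t * (p \<bullet> z)" using pC[OF C_scale[OF that]] by simp
    also have "t * (p \<bullet> z) = - (\<bar>d\<bar> + 1)" using neg by (simp add: t_def field_simps)
    finally show False by linarith
  qed
  have d: "d \<le> 0"
  proof (rule ccontr)
    assume "\<not> d \<le> 0"
    define X where "X = p \<bullet> (a, \<rho> a)"
    have "0 < X" using pC[OF aC] \<open>\<not> d \<le> 0\<close> by (simp add: X_def)
    then have "d \<le> d / (2 * X) * X"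
      using pC[OF C_scale[OF aC, of "d / (2 * X)"]] \<open>\<not> d \<le> 0\<close> by (simp only: X_def inner_scaleR_right) simp
    then show False using \<open>0 < X\<close> \<open>\<not> d \<le> 0\<close> by simp
  qed
  define \<alpha> where "\<alpha> = (- 1 / \<gamma>) *\<^sub>R \<beta>"
  have inner_\<alpha>: "\<alpha> \<bullet> x = - (\<beta> \<bullet> x) / \<gamma>" for x by (simp add: \<alpha>_def)
  have dom: "\<alpha> \<bullet> x \<le> r" if "(x, r) \<in> C" for x r
    using pC0[OF that] \<gamma> by (simp add: inner_p inner_\<alpha> field_simps)
  show thesis
  proof (rule that[of \<alpha>])
    show le: "\<alpha> \<bullet> b \<le> \<rho> b" if "b \<in> eccentricity_cone" for b
      by (rule dom, rule CI[OF that]) auto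
    (* Moving a down along the i-th axis stays inside C, so - t * \<alpha> $ i is bounded for t > 0. *)
    have "0 \<le> \<alpha> $ i" for i
    proof (rule ccontr)
      assume "\<not> 0 \<le> \<alpha> $ i"
      then have neg: "\<alpha> $ i < 0" by simp
      define t where "t = (\<bar>\<rho> a - \<alpha> \<bullet> a\<bar> + 1) / - \<alpha> $ i"
      have t: "0 < t" unfolding t_def using neg by (intro divide_pos_pos) auto
      have "(a - t *\<^sub>R axis i 1, \<rho> a) \<in> C"
        by (rule CI[OF a]) (use t in \<open>auto simp: axis_def\<close>)
      then have "\<alpha> \<bullet> a - t * \<alpha> $ i \<le> \<rho> a"
        using dom by (fastforce simp: inner_diff_right inner_axis)
      moreover have "t * \<alpha> $ i = - (\<bar>\<rho> a - \<alpha> \<bullet> a\<bar> + 1)" using neg by (simp add: t_def field_simps)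
      ultimately show False by linarith
    qed
    then show "\<alpha> \<in> nonneg_orthant" by (simp add: nonneg_orthant_def)
    have "\<rho> a \<le> \<alpha> \<bullet> a"
    proof (rule dense_le)
      fix r assume "r < \<rho> a"
      then have "p \<bullet> (a, r) \<le> 0" using pS[of "(a, r)"] d by (simp add: S_def)
      then show "r \<le> \<alpha> \<bullet> a" using \<gamma> by (simp add: inner_p inner_\<alpha> field_simps)
    qed
    then show "\<alpha> \<bullet> a = \<rho> a" using le[OF a] by simp
  qed
qed

theorem corollary3p5:
  fixes F :: "(real ^ 'n::{finite,linorder}) set"
  assumes "F \<noteq> {}" and "bounded F"
  shows "(\<forall>a\<in>eccentricity_cone.
            (\<exists>\<alpha>\<in>profile_body F. support_fun (profile_body F) a = ereal (\<alpha> \<bullet> a)) \<and>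
            support_fun (profile_body F) a = (SUP \<alpha>\<in>lower_print F. ereal (\<alpha> \<bullet> a)) \<and>
            (SUP \<alpha>\<in>lower_print F. ereal (\<alpha> \<bullet> a)) \<le> lower_profile F a) \<and>
         ((\<forall>a\<in>eccentricity_cone. support_fun (profile_body F) a = lower_profile F a) \<longleftrightarrow>
            subadditive_on eccentricity_cone (lower_profile F)) \<and>
         (subadditive_on eccentricity_cone (lower_profile F) \<longrightarrow>
            (\<forall>a\<in>eccentricity_cone. lower_profile F a = (SUP \<alpha>\<in>lower_print F. ereal (\<alpha> \<bullet> a))))"
proof -
  let ?K = "profile_body F" and ?\<rho> = "lower_profile F"
  have print: "(SUP \<alpha>\<in>lower_print F. ereal (\<alpha> \<bullet> a)) = support_fun ?K a" for a
    using support_fun_lower_print[OF assms, of a] by (simp add: support_fun_def)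
  have max: "\<exists>\<alpha>\<in>?K. support_fun ?K a = ereal (\<alpha> \<bullet> a)" for a
    using support_fun_attained[OF compact_profile_body[OF assms]] zero_in_profile_body[OF assms]
    by (metis empty_iff)
  have le: "support_fun ?K a \<le> ?\<rho> a" if "a \<in> eccentricity_cone" for a
    unfolding support_fun_def using that by (auto simp: profile_body_def intro!: SUP_least)
  have eq: "support_fun ?K a = ?\<rho> a"
    if sub: "subadditive_on eccentricity_cone ?\<rho>" and a: "a \<in> eccentricity_cone" for a
  proof -
    define g where "g x = real_of_ereal (?\<rho> x)" for x
    have g: "?\<rho> x = ereal (g x)" if "x \<in> eccentricity_cone" for x
      unfolding g_def using lower_profile_finite[OF assms that] by (simp add: ereal_real)
    obtain \<alpha> where \<alpha>: "\<alpha> \<in> nonneg_orthant" "\<And>b. b \<in> eccentricity_cone \<Longrightarrow> \<alpha> \<bullet> b \<le> g b"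
      "\<alpha> \<bullet> a = g a"
    proof (rule monotone_sublinear_supporting_vector[OF _ _ _ a, of g])
      show "g (t *\<^sub>R x) = t * g x" if "0 < t" "x \<in> eccentricity_cone" for t x
        using lower_profile_homogeneous[OF that(1), of F x] by (simp add: g_def)
      show "g (x + y) \<le> g x + g y" if "x \<in> eccentricity_cone" "y \<in> eccentricity_cone" for x y
        using sub that g cone_add unfolding subadditive_on_def
        by (metis ereal_less_eq(3) plus_ereal.simps(1))
      show "g x \<le> g y" if "x \<in> eccentricity_cone" "y \<in> eccentricity_cone" "\<And>i. x $ i \<le> y $ i" for x y
        using lower_profile_mono[OF assms that] that g by simp
    qed (use that in blast)
    have "\<alpha> \<in> ?K" using \<alpha> g by (simp add: profile_body_def)
    then have "ereal (\<alpha> \<bullet> a) \<le> support_fun ?K a" unfolding support_fun_def by (rule SUP_upper)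
    then show ?thesis using le[OF a] \<alpha>(3) g[OF a] by simp
  qed
  have "subadditive_on eccentricity_cone ?\<rho>"
    if "\<forall>a\<in>eccentricity_cone. support_fun ?K a = ?\<rho> a"
    unfolding subadditive_on_def using that support_fun_subadditive cone_add by metis
  then show ?thesis unfolding print using max le eq by metis
qed

end
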